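(* There exists a monotonically growing temporal clique $\mathcal{C}$ (a monotonically growing temporal graph whose underlying static graph is complete) such that the two-player temporal Voronoi game $\mathrm{Vor}(\mathcal{C},2)$ has no Nash equilibrium; and for each integer $k\ge 2$ there exists a monotonically growing temporal complete $k$-partite graph $\mathcal{K}$ (a monotonically growing temporal graph whose underlying static graph is complete $k$-partite) such that $\mathrm{Vor}(\mathcal{K},2)$ has no Nash equilibrium.
   Context: A temporal graph $\mathcal{G}=(V,(E_t)_{t=1}^\infty)$ consists of a finite nonempty vertex set $V$ and an infinite sequence of edge sets $E_t\subseteq\binom{V}{2}$; it is assumed that the sequence is eventually constant (finite lifetime), i.e. there is $\tau$ with $E_t=E_\tau$ for all $t\ge\tau$. The underlying static graph is $(V,\bigcup_{t\ge1}E_t)$. A static graph is complete $k$-partite if its vertex set is partitioned into $k$ nonempty parts such that two vertices are adjacent if and only if they lie in different parts. $\mathcal{G}$ is monotonically growing if $E_t\subseteq E_{t+1}$ for all $t\ge 1$. A temporal walk from $u$ to $v$ is a sequence $(\{v_0=u,v_1\},t_1),(\{v_1,v_2\},t_2),\dots,(\{v_{d-1},v_d=v\},t_d)$ with $t_i<t_{i+1}$ for all $i\in\{1,\dots,d-1\}$ (strictly increasing times) and $\{v_{i-1},v_i\}\in E_{t_i}$ for all $i\in\{1,\dots,d\}$; its arrival time is $t_d$. The temporal distance $\mathrm{td}(u,v)$ is the minimum arrival time of a temporal walk from $u$ to $v$, with $\mathrm{td}(u,u)=0$ and $\mathrm{td}(u,v)=\infty$ if there is no such walk. In the two-player temporal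 Voronoi game $\mathrm{Vor}(\mathcal{G},2)$, each player $i\in\{1,2\}$ selects one vertex $p_i\in V$ (equal choices are allowed). Player $i$ wins the set $U_i(p_1,p_2)=\{v\in V\mid \mathrm{td}(p_i,v)<\mathrm{td}(p_j,v)\}$, where $j\ne i$ is the other player, and her payoff is $u_i(p_1,p_2)=|U_i(p_1,p_2)|$. A profile $(p_1,p_2)\in V^2$ is a Nash equilibrium if $u_1(p',p_2)\le u_1(p_1,p_2)$ and $u_2(p_1,p')\le u_2(p_1,p_2)$ for all $p'\in V$. *)

theory Defs
  imports "HOL-Library.Extended_Nat" "HOL-Library.Disjoint_Sets" "HOL-Library.Ramsey"
begin

(* A temporal graph is given by its vertex set V and edge sets E t for t >= 1;
   the value E 0 is never consulted. The set nsets V 2 consists of the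
   two-element subsets of V. *)

definition temporal_graph :: "'a set \<Rightarrow> (nat \<Rightarrow> 'a set set) \<Rightarrow> bool" where
  "temporal_graph V E \<longleftrightarrow>
     finite V \<and> V \<noteq> {} \<and>
     (\<forall>t\<ge>1. E t \<subseteq> nsets V 2) \<and>
     (\<exists>\<tau>\<ge>1. \<forall>t\<ge>\<tau>. E t = E \<tau>)"

definition monotonically_growing :: "(nat \<Rightarrow> 'a set set) \<Rightarrow> bool" where
  "monotonically_growing E \<longleftrightarrow> (\<forall>t\<ge>1. E t \<subseteq> E (t + 1))"

definition underlying_edges :: "(nat \<Rightarrow> 'a set set) \<Rightarrow> 'a set set" where
  "underlying_edges E = (\<Union>t\<in>{1..}. E t)"

definition complete_graph :: "'a set \<Rightarrow> 'a set set \<Rightarrow> bool" where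
  "complete_graph V F \<longleftrightarrow> F = nsets V 2"

definition complete_multipartite :: "nat \<Rightarrow> 'a set \<Rightarrow> 'a set set \<Rightarrow> bool" where
  "complete_multipartite k V F \<longleftrightarrow>
     F \<subseteq> nsets V 2 \<and>
     (\<exists>P. partition_on V P \<and> finite P \<and> card P = k \<and>
        (\<forall>u\<in>V. \<forall>v\<in>V. {u, v} \<in> F \<longleftrightarrow> \<not> (\<exists>A\<in>P. u \<in> A \<and> v \<in> A)))"

definition temporal_clique :: "'a set \<Rightarrow> (nat \<Rightarrow> 'a set set) \<Rightarrow> bool" where
  "temporal_clique V E \<longleftrightarrow>
     temporal_graph V E \<and> complete_graph V (underlying_edges E)"

definition temporal_complete_multipartite :: "nat \<Rightarrow> 'a set \<Rightarrow> (nat \<Rightarrow> 'a set set) \<Rightarrow> bool" where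
  "temporal_complete_multipartite k V E \<longleftrightarrow>
     temporal_graph V E \<and> complete_multipartite k V (underlying_edges E)"

(* The walk visits vs = [v_0, ..., v_d] at times ts = [t_1, ..., t_d] with d >= 1,
   so the edge {v_i, v_(i+1)} is used at time ts ! i. *)

definition temporal_walk ::
  "(nat \<Rightarrow> 'a set set) \<Rightarrow> 'a \<Rightarrow> 'a \<Rightarrow> 'a list \<Rightarrow> nat list \<Rightarrow> bool" where
  "temporal_walk E u v vs ts \<longleftrightarrow>
     ts \<noteq> [] \<and> length vs = length ts + 1 \<and> hd vs = u \<and> last vs = v \<and>
     sorted_wrt (<) ts \<and>
     (\<forall>i<length ts. 1 \<le> ts ! i \<and> {vs ! i, vs ! (i + 1)} \<in> E (ts ! i))"

(* The infimum in enat is a minimum on nonempty sets, and is \<infinity> on the empty set. *)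

definition temporal_dist :: "(nat \<Rightarrow> 'a set set) \<Rightarrow> 'a \<Rightarrow> 'a \<Rightarrow> enat" where
  "temporal_dist E u v =
     (if u = v then 0 else Inf {enat (last ts) | vs ts. temporal_walk E u v vs ts})"

(* The vertices won by the player at p against an opponent at q. For the profile
   (p1, p2), player 1 wins voronoi_set V E p1 p2 and player 2 wins
   voronoi_set V E p2 p1. *)

definition voronoi_set :: "'a set \<Rightarrow> (nat \<Rightarrow> 'a set set) \<Rightarrow> 'a \<Rightarrow> 'a \<Rightarrow> 'a set" where
  "voronoi_set V E p q = {v \<in> V. temporal_dist E p v < temporal_dist E q v}"

definition payoff1 :: "'a set \<Rightarrow> (nat \<Rightarrow> 'a set set) \<Rightarrow> 'a \<Rightarrow> 'a \<Rightarrow> nat" where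
  "payoff1 V E p1 p2 = card (voronoi_set V E p1 p2)"

definition payoff2 :: "'a set \<Rightarrow> (nat \<Rightarrow> 'a set set) \<Rightarrow> 'a \<Rightarrow> 'a \<Rightarrow> nat" where
  "payoff2 V E p1 p2 = card (voronoi_set V E p2 p1)"

definition nash_equilibrium :: "'a set \<Rightarrow> (nat \<Rightarrow> 'a set set) \<Rightarrow> 'a \<Rightarrow> 'a \<Rightarrow> bool" where
  "nash_equilibrium V E p1 p2 \<longleftrightarrow>
     p1 \<in> V \<and> p2 \<in> V \<and>
     (\<forall>p\<in>V. payoff1 V E p p2 \<le> payoff1 V E p1 p2) \<and>
     (\<forall>p\<in>V. payoff2 V E p1 p \<le> payoff2 V E p1 p2)"

end

theory Submission
  imports Defs
begin

text \<open>
  A hexagon 0-1-2-3-4-5 with a twin 6 of the vertex 0 and pendant vertices 7 and 8 at 2 and 4 is a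
  connected bipartite static graph of diameter 4 whose Voronoi game has no equilibrium. Keep it
  constant up to time 4 and add all missing edges at time 5: by then every vertex has
  been reached, so the game is unchanged. Further singleton parts are isolated until time 5.
  They are reached at time 5 from everywhere, so nobody wins them except by choosing them, and
  choosing one wins nothing else.
\<close>

section \<open>Temporal walks and certificates for temporal distances\<close>

lemma temporal_walk_snoc:
  assumes "temporal_walk E u w vs ts" "last ts < t" "{w, v} \<in> E t"
  shows "temporal_walk E u v (vs @ [v]) (ts @ [t])"
proof -
  have w: "ts \<noteq> []" "length vs = length ts + 1" "hd vs = u" "last vs = w" "sorted_wrt (<) ts"
    "\<And>i. i < length ts \<Longrightarrow> 1 \<le> ts ! i \<and> {vs ! i, vs ! (i + 1)} \<in> E (ts ! i)"
    using assms(1) unfolding temporal_walk_def by auto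
  have "vs \<noteq> []" using w(2) by auto
  have vs_last: "vs ! length ts = w"
    using w(2,4) \<open>vs \<noteq> []\<close> by (simp add: last_conv_nth)
  have "s \<le> last ts" if "s \<in> set ts" for s
    using w(5) that by (induction ts) (auto split: if_splits intro: less_imp_le)
  then have "sorted_wrt (<) (ts @ [t])"
    using w(5) assms(2) by (fastforce simp: sorted_wrt_append)
  moreover have "1 \<le> t" using assms(2) by simp
  ultimately show ?thesis
    unfolding temporal_walk_def using w(1-4,6) assms(3) \<open>vs \<noteq> []\<close> vs_last
    by (auto simp: nth_append less_Suc_eq)
qed

text \<open>Two local conditions certify \<open>d\<close> as the distance. By \<open>d_step\<close>,
  \<open>d\<close> never exceeds the time of the edge just used along a walk, which bounds arrival
  times from below. Descending by \<open>d_pred\<close> yields a walk arriving at time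
  \<open>d v\<close>; its times increase strictly because \<open>d\<close> drops strictly.\<close>

lemma temporal_dist_eqI:
  fixes d :: "'a \<Rightarrow> nat"
  assumes d_start: "d u = 0"
    and d_step: "\<And>w v t. \<lbrakk>1 \<le> t; {w, v} \<in> E t; d w < t\<rbrakk> \<Longrightarrow> d v \<le> t"
    and d_pred: "\<And>v. \<lbrakk>v \<in> V; v \<noteq> u\<rbrakk> \<Longrightarrow> \<exists>w\<in>V. d w < d v \<and> {w, v} \<in> E (d v)"
    and "v \<in> V"
  shows "temporal_dist E u v = enat (d v)"
proof (cases "v = u")
  case True
  then show ?thesis by (simp add: temporal_dist_def d_start zero_enat_def)
next
  case False
  have lower: "d v \<le> last ts" if walk: "temporal_walk E u v vs ts" for v vs ts
  proof -
    have w: "ts \<noteq> []" "length vs = length ts + 1" "hd vs = u" "last vs = v" "sorted_wrt (<) ts"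
      "\<And>i. i < length ts \<Longrightarrow> 1 \<le> ts ! i \<and> {vs ! i, vs ! (i + 1)} \<in> E (ts ! i)"
      using walk unfolding temporal_walk_def by auto
    have "vs \<noteq> []" using w(2) by auto
    have "d (vs ! (i + 1)) \<le> ts ! i" if "i < length ts" for i
      using that
    proof (induction i)
      case 0
      then show ?case
        using d_step[OF _ conjunct2[OF w(6)[OF 0]]] w(6)[OF 0] w(3) \<open>vs \<noteq> []\<close> d_start
        by (auto simp: hd_conv_nth)
    next
      case (Suc i)
      have "ts ! i < ts ! Suc i"
        using w(5) Suc.prems by (simp add: sorted_wrt_iff_nth_less)
      with Suc show ?case
        using d_step[OF _ conjunct2[OF w(6)[OF Suc.prems]]] w(6)[OF Suc.prems] by auto
    qed
    from this[of "length ts - 1"] show ?thesis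
      using w(1,2,4) \<open>vs \<noteq> []\<close> by (simp add: last_conv_nth)
  qed
  have upper: "\<exists>vs ts. temporal_walk E u v vs ts \<and> last ts = d v" if "v \<in> V" "v \<noteq> u" for v
    using that
  proof (induction "d v" arbitrary: v rule: less_induct)
    case less
    obtain w where w: "w \<in> V" "d w < d v" "{w, v} \<in> E (d v)"
      using d_pred less.prems by blast
    show ?case
    \<comment> \<open>The induction hypothesis leaves out \<open>u\<close>: walks are nonempty and
      times start at 1, so none arrives at time \<open>d u = 0\<close>.\<close>
    proof (cases "w = u")
      case True
      then have "temporal_walk E u v [u, v] [d v]"
        using w by (auto simp: temporal_walk_def)
      then show ?thesis by force
    next
      case False
      obtain vs ts where "temporal_walk E u w vs ts" "last ts = d w"
        using less.hyps[OF w(2,1) False] by blast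
      then have "temporal_walk E u v (vs @ [v]) (ts @ [d v])"
        using w by (auto intro: temporal_walk_snoc)
      then show ?thesis by force
    qed
  qed
  have "Inf {enat (last ts) | vs ts. temporal_walk E u v vs ts} = enat (d v)"
    using lower upper[OF \<open>v \<in> V\<close> False]
    by (intro antisym Inf_greatest Inf_lower) (auto, metis)
  then show ?thesis using False by (simp add: temporal_dist_def)
qed

section \<open>The static graph on nine vertices and its Voronoi game\<close>

definition hex_edges :: "(nat \<times> nat) list" where
  "hex_edges = [(0,1), (1,2), (2,3), (3,4), (4,5), (5,0), (6,1), (6,5), (2,7), (4,8)]"

definition hex_adj :: "nat \<Rightarrow> nat \<Rightarrow> bool" where
  "hex_adj u v \<longleftrightarrow> (u, v) \<in> set hex_edges \<or> (v, u) \<in> set hex_edges"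

text \<open>The matrix of graph distances, tabulated so that finite checks can be evaluated. Its
  entries are justified only by the local lemmas below, which feed
  \<open>temporal_dist_eqI\<close>.\<close>

definition hex_dist :: "nat \<Rightarrow> nat \<Rightarrow> nat" where
  "hex_dist u v =
    [[0, 1, 2, 3, 2, 1, 2, 3, 3],
     [1, 0, 1, 2, 3, 2, 1, 2, 4],
     [2, 1, 0, 1, 2, 3, 2, 1, 3],
     [3, 2, 1, 0, 1, 2, 3, 2, 2],
     [2, 3, 2, 1, 0, 1, 2, 3, 1],
     [1, 2, 3, 2, 1, 0, 1, 4, 2],
     [2, 1, 2, 3, 2, 1, 0, 3, 3],
     [3, 2, 1, 2, 3, 4, 3, 0, 4],
     [3, 4, 3, 2, 1, 2, 3, 4, 0]] ! u ! v"

definition hex_payoff :: "nat \<Rightarrow> nat \<Rightarrow> nat" where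
  "hex_payoff p q = length (filter (\<lambda>v. hex_dist p v < hex_dist q v) [0..<9])"

lemma all_less_9:
  "(\<forall>u<9. P u) \<longleftrightarrow> P 0 \<and> P 1 \<and> P 2 \<and> P 3 \<and> P 4 \<and> P 5 \<and> P 6 \<and> P 7 \<and> P 8" for P :: "nat \<Rightarrow> bool"
  by (simp add: numeral_eq_Suc All_less_Suc conj_ac)

lemma ex_less_9:
  "(\<exists>u<9. P u) \<longleftrightarrow> P 0 \<or> P 1 \<or> P 2 \<or> P 3 \<or> P 4 \<or> P 5 \<or> P 6 \<or> P 7 \<or> P 8" for P :: "nat \<Rightarrow> bool"
  by (simp add: numeral_eq_Suc Ex_less_Suc disj_ac)

lemma upt_9: "[0..<9] = [0, 1, 2, 3, 4, 5, 6, 7, 8]"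
  by (simp add: upt_conv_Cons)

lemma hex_adj_less: "hex_adj u v \<Longrightarrow> u < 9 \<and> v < 9"
  by (auto simp: hex_adj_def hex_edges_def)

lemma hex_dist_self: "\<forall>u<9. hex_dist u u = 0"
  unfolding all_less_9 by (simp add: hex_dist_def)

lemma hex_dist_le: "\<forall>u<9. \<forall>v<9. hex_dist u v \<le> 4"
  unfolding all_less_9 by (simp add: hex_dist_def)

text \<open>Serves \<open>d_step\<close> before time 5: leaving \<open>w\<close> strictly after time
  \<open>hex_dist u w\<close> costs at least one time unit. The next lemma serves
  \<open>d_pred\<close>.\<close>

lemma hex_dist_step: "\<forall>u<9. \<forall>w<9. \<forall>v<9. hex_adj w v \<longrightarrow> hex_dist u v \<le> hex_dist u w + 1"
  by (auto simp: all_less_9 hex_adj_def hex_edges_def hex_dist_def)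

lemma hex_dist_pred:
  "\<forall>u<9. \<forall>v<9. v \<noteq> u \<longrightarrow> (\<exists>w<9. hex_dist u w < hex_dist u v \<and> hex_adj w v)"
  unfolding all_less_9 ex_less_9 by (simp add: hex_adj_def hex_edges_def hex_dist_def)

text \<open>
  Every vertex has a reply worth at least 5, but the two players never both get 5. (Best replies to
  1, 2, 5, 4 are 2, 5, 4, 1, so best-reply dynamics run around this cycle.)
\<close>

lemma hex_reply: "\<forall>q<9. \<exists>p<9. 5 \<le> hex_payoff p q"
proof -
  have "\<forall>q<9. 5 \<le> hex_payoff ([1, 2, 5, 2, 1, 4, 1, 2, 4] ! q) q \<and>
      [1, 2, 5, 2, 1, 4, 1, 2, 4] ! q < (9 :: nat)"
    unfolding all_less_9 hex_payoff_def upt_9 by code_simp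
  then show ?thesis by blast
qed

text \<open>The players win disjoint sets among nine vertices, so 5 is a strict majority that only
  one of them can have.\<close>

lemma hex_conflict: "\<forall>p<9. \<forall>q<9. hex_payoff p q < 5 \<or> hex_payoff q p < 5"
  unfolding all_less_9 hex_payoff_def upt_9 by code_simp

section \<open>Complete multipartite graphs from colourings, and the temporal extension\<close>

definition multipartite_edges :: "('a \<Rightarrow> 'b) \<Rightarrow> 'a set \<Rightarrow> 'a set set" where
  "multipartite_edges c V = {{u, v} | u v. u \<in> V \<and> v \<in> V \<and> c u \<noteq> c v}"

definition hex_temporal :: "(nat \<Rightarrow> 'b) \<Rightarrow> nat set \<Rightarrow> nat \<Rightarrow> nat set set" where
  "hex_temporal c V t =
    (if t < 5 then {{u, v} | u v. hex_adj u v} else multipartite_edges c V)"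

lemma mem_multipartite_edges:
  "{u, v} \<in> multipartite_edges c V \<longleftrightarrow> u \<in> V \<and> v \<in> V \<and> c u \<noteq> c v"
  by (auto simp: multipartite_edges_def doubleton_eq_iff)

lemma mem_hex_temporal:
  "{u, v} \<in> hex_temporal c V t \<longleftrightarrow>
    (if t < 5 then hex_adj u v else u \<in> V \<and> v \<in> V \<and> c u \<noteq> c v)"
  by (auto simp: hex_temporal_def mem_multipartite_edges doubleton_eq_iff hex_adj_def)

lemma multipartite_edges_subset: "multipartite_edges c V \<subseteq> nsets V 2"
  by (auto simp: multipartite_edges_def nsets_def card_insert_if)

lemma complete_multipartite_multipartite_edges:
  assumes "finite V"
  shows "complete_multipartite (card (c ` V)) V (multipartite_edges c V)"
proof -
  \<comment> \<open>Only attained colours are used, so that no part is empty and distinct colours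
    give distinct parts.\<close>
  define P where "P = (\<lambda>i. {v \<in> V. c v = i}) ` c ` V"
  have "partition_on V P"
    by (rule partition_onI) (auto simp: P_def disjnt_def)
  moreover have "card P = card (c ` V)"
    unfolding P_def by (rule card_image) (auto simp: inj_on_def)
  moreover have "{u, v} \<in> multipartite_edges c V \<longleftrightarrow> \<not> (\<exists>A\<in>P. u \<in> A \<and> v \<in> A)"
    if "u \<in> V" "v \<in> V" for u v
    using that by (auto simp: mem_multipartite_edges P_def)
  ultimately show ?thesis
    using multipartite_edges_subset[of c V] assms
    unfolding complete_multipartite_def by (auto simp: P_def intro!: exI[of _ P])
qed

text \<open>The vertices below 9 form the core, the others are extra. \<open>proper\<close> makes
  the core edges survive at time 5, whence growth; \<open>singleton\<close> joins each extra vertex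
  to all others at time 5.\<close>

context
  fixes c :: "nat \<Rightarrow> 'b" and V :: "nat set"
  assumes fin: "finite V" and sub: "{..<9} \<subseteq> V"
    and proper: "\<And>u v. hex_adj u v \<Longrightarrow> c u \<noteq> c v"
    and singleton: "\<And>u v. \<lbrakk>u \<in> V; v \<in> V; c u = c v; u \<noteq> v\<rbrakk> \<Longrightarrow> u < 9 \<and> v < 9"
begin

lemma hex_temporal_subset: "hex_temporal c V t \<subseteq> multipartite_edges c V"
proof -
  have "u \<in> V \<and> v \<in> V \<and> c u \<noteq> c v" if "hex_adj u v" for u v
    using hex_adj_less[OF that] proper[OF that] sub by auto
  then show ?thesis
    unfolding hex_temporal_def multipartite_edges_def by auto
qed

lemma temporal_graph_hex: "temporal_graph V (hex_temporal c V)"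
proof -
  have "\<exists>\<tau>\<ge>1. \<forall>t\<ge>\<tau>. hex_temporal c V t = hex_temporal c V \<tau>"
    by (intro exI[of _ 5]) (simp add: hex_temporal_def)
  moreover have "0 \<in> V" using sub by auto
  ultimately show ?thesis
    unfolding temporal_graph_def
    using fin subset_trans[OF hex_temporal_subset multipartite_edges_subset] by auto
qed

lemma monotonically_growing_hex: "monotonically_growing (hex_temporal c V)"
proof -
  have "hex_temporal c V t \<subseteq> hex_temporal c V (t + 1)" for t
  proof (cases "t + 1 < 5")
    case True
    then show ?thesis by (simp add: hex_temporal_def)
  next
    case False
    then have "hex_temporal c V (t + 1) = multipartite_edges c V"
      by (simp add: hex_temporal_def)
    then show ?thesis using hex_temporal_subset by simp
  qed
  then show ?thesis by (simp add: monotonically_growing_def)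
qed

lemma underlying_edges_hex: "underlying_edges (hex_temporal c V) = multipartite_edges c V"
proof -
  have "hex_temporal c V 5 = multipartite_edges c V" by (simp add: hex_temporal_def)
  moreover have "hex_temporal c V 5 \<subseteq> underlying_edges (hex_temporal c V)"
    unfolding underlying_edges_def by (rule UN_upper) simp
  moreover have "underlying_edges (hex_temporal c V) \<subseteq> multipartite_edges c V"
    unfolding underlying_edges_def by (intro UN_least hex_temporal_subset)
  ultimately show ?thesis by simp
qed

text \<open>Core distances are at most 4, so the edges added at time 5 cannot shorten them. An extra
  vertex has no edge before time 5 and then a direct edge to every other vertex.\<close>

lemma temporal_dist_hex:
  assumes "u \<in> V" "v \<in> V"
  shows "temporal_dist (hex_temporal c V) u v =
    enat (if u = v then 0 else if u < 9 \<and> v < 9 then hex_dist u v else 5)"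
proof -
  define d where "d v = (if u = v then 0 else if u < 9 \<and> v < 9 then hex_dist u v else 5)" for v
  have d_le: "d v \<le> 5" for v
    using hex_dist_le by (fastforce simp: d_def)
  have d_hex: "d v = hex_dist u v" if "u < 9" "v < 9" for v
    using that hex_dist_self by (auto simp: d_def)
  have "temporal_dist (hex_temporal c V) u v = enat (d v)"
  proof (rule temporal_dist_eqI[where V = V])
    show "d u = 0" by (simp add: d_def)
  next
    fix w v t
    assume t: "1 \<le> t" "{w, v} \<in> hex_temporal c V t" "d w < t"
    show "d v \<le> t"
    proof (cases "t < 5")
      case True
      then have adj: "hex_adj w v" using t(2) by (simp add: mem_hex_temporal)
      then have "w < 9" "v < 9" using hex_adj_less by auto
      \<comment> \<open>From an extra \<open>u\<close> the core vertex \<open>w\<close> would have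
        \<open>d w = 5\<close>, contradicting \<open>d w < t < 5\<close>.\<close>
      moreover have "u < 9"
        using t(3) True \<open>w < 9\<close> by (auto simp: d_def split: if_splits)
      ultimately have "hex_dist u v \<le> hex_dist u w + 1"
        using hex_dist_step adj by blast
      then show ?thesis using t(3) d_hex \<open>u < 9\<close> \<open>v < 9\<close> \<open>w < 9\<close> by auto
    next
      case False
      then show ?thesis using d_le[of v] by linarith
    qed
  next
    fix v assume v: "v \<in> V" "v \<noteq> u"
    show "\<exists>w\<in>V. d w < d v \<and> {w, v} \<in> hex_temporal c V (d v)"
    proof (cases "u < 9 \<and> v < 9")
      case True
      then obtain w where w: "w < 9" "hex_dist u w < hex_dist u v" "hex_adj w v"
        using hex_dist_pred v by blast
      moreover have "hex_dist u v < 5" using hex_dist_le True by fastforce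
      ultimately show ?thesis
        using True sub by (intro bexI[of _ w]) (auto simp: d_hex mem_hex_temporal)
    next
      case False
      then have "d u = 0" "d v = 5" "c u \<noteq> c v"
        using v singleton[of u v] assms(1) by (auto simp: d_def)
      then show ?thesis
        using v assms(1) by (intro bexI[of _ u]) (auto simp: mem_hex_temporal)
    qed
  qed fact
  then show ?thesis by (simp add: d_def)
qed

section \<open>Payoffs in the temporal game and absence of equilibria\<close>

lemma payoff1_hex:
  assumes "p < 9" "q < 9"
  shows "payoff1 V (hex_temporal c V) p q = hex_payoff p q"
proof -
  \<comment> \<open>From the core, every extra vertex is at distance 5, hence a tie between core
    players.\<close>
  have dist: "temporal_dist (hex_temporal c V) u v = enat (if v < 9 then hex_dist u v else 5)"
    if "u < 9" "v \<in> V" for u v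
  proof -
    have "u \<in> V" using that sub by auto
    then show ?thesis using that hex_dist_self by (auto simp: temporal_dist_hex)
  qed
  have "voronoi_set V (hex_temporal c V) p q = set (filter (\<lambda>v. hex_dist p v < hex_dist q v) [0..<9])"
    using assms sub by (auto simp: voronoi_set_def dist subset_iff split: if_splits)
  then show ?thesis
    by (simp add: payoff1_def hex_payoff_def distinct_card del: set_filter)
qed

text \<open>An extra \<open>p\<close> needs time 5 for every vertex but itself, and no distance
  exceeds 5.\<close>

lemma payoff1_extra:
  assumes "p \<in> V" "q \<in> V" "\<not> p < 9"
  shows "payoff1 V (hex_temporal c V) p q \<le> 1"
proof -
  have "\<not> 5 < hex_dist q v" if "q < 9" "v < 9" for v
    using hex_dist_le that by fastforce
  then have "voronoi_set V (hex_temporal c V) p q \<subseteq> {p}"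
    using assms(3)
    by (auto simp: voronoi_set_def temporal_dist_hex[OF assms(1)] temporal_dist_hex[OF assms(2)]
        split: if_splits)
  then have "card (voronoi_set V (hex_temporal c V) p q) \<le> card {p}"
    by (intro card_mono) auto
  then show ?thesis by (simp add: payoff1_def)
qed

text \<open>Vertex 0 reaches the whole core by time 4, before an extra opponent can move at all, and
  so wins nine vertices.\<close>

lemma payoff1_against_extra:
  assumes "q \<in> V" "\<not> q < 9"
  shows "5 \<le> payoff1 V (hex_temporal c V) 0 q"
proof -
  have "0 \<in> V" using sub by auto
  have "hex_dist 0 v < 5" if "v < 9" for v
    using hex_dist_le that by fastforce
  then have "{..<9} \<subseteq> voronoi_set V (hex_temporal c V) 0 q"
    using assms sub
    by (auto simp: voronoi_set_def temporal_dist_hex[OF \<open>0 \<in> V\<close>] temporal_dist_hex[OF assms(1)])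
  moreover have "finite (voronoi_set V (hex_temporal c V) 0 q)"
    using fin by (simp add: voronoi_set_def)
  ultimately have "card {..<9 :: nat} \<le> payoff1 V (hex_temporal c V) 0 q"
    unfolding payoff1_def by (rule card_mono[rotated])
  then show ?thesis by simp
qed

lemma payoff1_reply:
  assumes "q \<in> V"
  shows "\<exists>p\<in>V. 5 \<le> payoff1 V (hex_temporal c V) p q"
proof (cases "q < 9")
  case True
  then obtain p where "p < 9" "5 \<le> hex_payoff p q" using hex_reply by blast
  then show ?thesis using True sub by (intro bexI[of _ p]) (auto simp: payoff1_hex)
next
  case False
  then show ?thesis using payoff1_against_extra[OF assms] sub by (intro bexI[of _ 0]) auto
qed

lemma payoff1_conflict:
  assumes "p \<in> V" "q \<in> V"
  shows "payoff1 V (hex_temporal c V) p q < 5 \<or> payoff1 V (hex_temporal c V) q p < 5"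
proof (cases "p < 9 \<and> q < 9")
  case True
  then show ?thesis using hex_conflict by (simp add: payoff1_hex)
next
  case False
  then show ?thesis
    using payoff1_extra[OF assms] payoff1_extra[OF assms(2,1)] by linarith
qed

lemma no_nash_equilibrium_hex: "\<not> nash_equilibrium V (hex_temporal c V) p q"
proof
  assume "nash_equilibrium V (hex_temporal c V) p q"
  then have pq: "p \<in> V" "q \<in> V"
    \<comment> \<open>The game is symmetric: the second payoff is the first with swapped arguments,
      so the reply lemma applies to both players and gives each at least 5.\<close>
    and best: "\<forall>p'\<in>V. payoff1 V (hex_temporal c V) p' q \<le> payoff1 V (hex_temporal c V) p q"
      "\<forall>q'\<in>V. payoff1 V (hex_temporal c V) q' p \<le> payoff1 V (hex_temporal c V) q p"
    by (auto simp: nash_equilibrium_def payoff1_def payoff2_def)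
  obtain p' q' where "p' \<in> V" "5 \<le> payoff1 V (hex_temporal c V) p' q"
    "q' \<in> V" "5 \<le> payoff1 V (hex_temporal c V) q' p"
    using payoff1_reply pq by blast
  then have "5 \<le> payoff1 V (hex_temporal c V) p q" "5 \<le> payoff1 V (hex_temporal c V) q p"
    using best le_trans by blast+
  then show False
    using payoff1_conflict[OF pq] by linarith
qed

end

section \<open>Choice of colourings for the clique and for k parts\<close>

theorem corollary11:
  shows "(\<exists>(V :: nat set) E.
            temporal_clique V E \<and> monotonically_growing E \<and>
            \<not> (\<exists>p1 p2. nash_equilibrium V E p1 p2)) \<and>
         (\<forall>k::nat. k \<ge> 2 \<longrightarrow>
           (\<exists>(V :: nat set) E.
              temporal_complete_multipartite k V E \<and> monotonically_growing E \<and>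
              \<not> (\<exists>p1 p2. nash_equilibrium V E p1 p2)))"
proof (intro conjI allI impI)
  have proper: "u \<noteq> v" if "hex_adj u v" for u v
    using that by (auto simp: hex_adj_def hex_edges_def)
  \<comment> \<open>The identity colouring has singleton parts only, so the clique is an instance of
    the same construction, here without extra vertices.\<close>
  have complete: "multipartite_edges (\<lambda>v. v) V = nsets V 2" for V :: "nat set"
    by (auto simp: multipartite_edges_def nsets_def card_2_iff)
  have "temporal_clique {..<9} (hex_temporal (\<lambda>v. v) {..<9})"
    unfolding temporal_clique_def complete_graph_def
    using temporal_graph_hex[of "{..<9}" "\<lambda>v. v"] underlying_edges_hex[of "{..<9}" "\<lambda>v. v"] proper
    by (simp add: complete)
  moreover have "monotonically_growing (hex_temporal (\<lambda>v. v) {..<9})"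
    by (rule monotonically_growing_hex) (auto dest: proper)
  moreover have "\<not> nash_equilibrium {..<9} (hex_temporal (\<lambda>v. v) {..<9}) p q" for p q
    by (rule no_nash_equilibrium_hex) (auto dest: proper)
  ultimately show "\<exists>(V :: nat set) E. temporal_clique V E \<and> monotonically_growing E \<and>
      \<not> (\<exists>p1 p2. nash_equilibrium V E p1 p2)"
    by blast
next
  fix k :: nat assume k: "2 \<le> k"
  \<comment> \<open>Nine core vertices fill two parts, and \<open>k - 2\<close> extra vertices are
    the remaining ones.\<close>
  define V where "V = {..<k + 7}"
  \<comment> \<open>The vertices 0-7 are bipartitioned by parity, 8 is on the odd side, the rest are singletons.\<close>
  define c :: "nat \<Rightarrow> nat" where "c v = (if v < 8 then v mod 2 else v - 7)" for v
  have fin: "finite V" and sub: "{..<9} \<subseteq> V" using k by (auto simp: V_def)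
  have proper: "c u \<noteq> c v" if "hex_adj u v" for u v
    using that by (auto simp: hex_adj_def hex_edges_def c_def)
  have "u < 9" if "c u = c v" "u \<noteq> v" for u v
    using that by (auto simp: c_def split: if_splits)
  then have singleton: "u < 9 \<and> v < 9" if "c u = c v" "u \<noteq> v" for u v
    using that by metis
  have "c ` V = {..<k}"
  proof (intro equalityI subsetI)
    fix i assume "i \<in> c ` V"
    then obtain v where v: "v < k + 7" "i = c v" by (auto simp: V_def)
    have "v mod 2 < 2" by simp
    then show "i \<in> {..<k}" using v k by (auto simp: c_def)
  next
    fix i assume i: "i \<in> {..<k}"
    show "i \<in> c ` V"
    proof (cases "i = 0")
      case True
      then show ?thesis using k by (intro image_eqI[of _ _ 0]) (auto simp: c_def V_def)
    next
      case False
      \<comment> \<open>Positive colours are attained from vertex 8 on, where \<open>c\<close>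
        subtracts 7; vertex 8 itself has colour 1.\<close>
      then show ?thesis using i by (intro image_eqI[of _ _ "i + 7"]) (auto simp: c_def V_def)
    qed
  qed
  then have "complete_multipartite k V (multipartite_edges c V)"
    using complete_multipartite_multipartite_edges[OF fin, of c] by simp
  then have "temporal_complete_multipartite k V (hex_temporal c V)"
    unfolding temporal_complete_multipartite_def
    using temporal_graph_hex[OF fin sub proper singleton]
      underlying_edges_hex[OF fin sub proper singleton] by simp
  moreover have "monotonically_growing (hex_temporal c V)"
    using monotonically_growing_hex[OF fin sub proper singleton] .
  moreover have "\<not> nash_equilibrium V (hex_temporal c V) p q" for p q
    using no_nash_equilibrium_hex[OF fin sub proper singleton] .
  ultimately show "\<exists>(V :: nat set) E. temporal_complete_multipartite k V E \<and>
      monotonically_growing E \<and> \<not> (\<exists>p1 p2. nash_equilibrium V E p1 p2)"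
    by blast
qed

end
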